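(* For a fixed positive integer $j$, let \[ \rho_j=\lim_{n\to\infty}\bigg((n+1)^{-(n-1)}\sum_{i=1}^nq_n(i,j)\bigg) \] be the asymptotic probability, as $n\to\infty$, that the $j$-th spot is lucky in a uniformly random parking function of $1,\ldots,n$. Then the limit exists for $1\le j\le 5$ and \[ \rho_1=1,\quad \rho_2=\tfrac34-\tfrac14e^{-2},\quad \rho_3=\tfrac23-\tfrac23e^{-3},\quad \rho_4=\tfrac58-\tfrac{13}8e^{-4},\quad \rho_5=\tfrac35-\tfrac{59}{15}e^{-5}. \]
   Context: There are $n$ spots labeled $1,\ldots,n$ in order along a one-way street, and $n$ cars entering one after another, car $i$ having preference $a_i\in\{1,\ldots,n\}$. Each car drives to its preferred spot and parks there if it is available; otherwise it moves forward and parks in the first available later spot, if any (if none, it fails to park). A parking function of $1,\ldots,n$ is a sequence of preferences $(a_1,\ldots,a_n)$ such that all $n$ cars are able to park; there are $(n+1)^{n-1}$ of them. A car is lucky if it parks in its preferred spot; a spot is lucky if the car that parks in it prefers that spot. For $1\le i,j\le n$, $q_n(i,j)$ denotes the number of parking functions of $1,\ldots,n$ in which the $i$-th car prefers the $j$-th spot and the $i$-th car is lucky, so $\sum_{i=1}^n q_n(i,j)$ is the number of parking functions for which the $j$-th spot is lucky. *)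

theory Defs
  imports "HOL-Analysis.Analysis"
begin

definition park_spot :: "nat \<Rightarrow> nat set \<Rightarrow> nat \<Rightarrow> nat option" where
  "park_spot n occ a =
     (let free = {s \<in> {a..n}. s \<notin> occ} in if free = {} then None else Some (Min free))"

text \<open>The cars of the list enter in order, with \<open>occ\<close> the set of spots already taken; the result
  lists the spot in which each car parks, \<open>None\<close> meaning that the car fails to park.\<close>

primrec park_outcome :: "nat \<Rightarrow> nat set \<Rightarrow> nat list \<Rightarrow> nat option list" where
  "park_outcome n occ [] = []"
| "park_outcome n occ (a # as) =
     (let r = park_spot n occ a in r # park_outcome n (occ \<union> set_option r) as)"

definition parking_functions :: "nat \<Rightarrow> nat list set" where
  "parking_functions n =
     {as. length as = n \<and> set as \<subseteq> {1..n} \<and> None \<notin> set (park_outcome n {} as)}"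

text \<open>Cars are numbered from 1, list positions from 0.\<close>

definition car_pref :: "nat list \<Rightarrow> nat \<Rightarrow> nat" where
  "car_pref as i = as ! (i - 1)"

definition lucky_car :: "nat \<Rightarrow> nat list \<Rightarrow> nat \<Rightarrow> bool" where
  "lucky_car n as i \<longleftrightarrow> park_outcome n {} as ! (i - 1) = Some (car_pref as i)"

definition q :: "nat \<Rightarrow> nat \<Rightarrow> nat \<Rightarrow> nat" where
  "q n i j = card {as \<in> parking_functions n. car_pref as i = j \<and> lucky_car n as i}"

definition lucky_spot_prob :: "nat \<Rightarrow> nat \<Rightarrow> real" where
  "lucky_spot_prob j n = (\<Sum>i = 1..n. real (q n i j)) / real (n + 1) ^ (n - 1)"

definition rho :: "nat \<Rightarrow> real" where
  "rho j = lim (lucky_spot_prob j)"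

end

theory Submission
  imports Defs
begin

text \<open>Let \<open>P\<^sub>n\<close> count the parking functions of \<open>1, \<dots>, n\<close>, and let \<open>F\<close> and \<open>L\<^sub>i\<close> be the exponential
  generating functions of all parking functions and of those in which spot \<open>i + 1\<close> is lucky.
  If the last car parks in spot \<open>m\<close>, it has \<open>m\<close> possible preferences
  (one, if \<open>m\<close> must be lucky) and the other cars form two independent parking functions on the two
  sides of \<open>m\<close>. With \<open>p\<^sub>m = P\<^sub>m / m!\<close> this says \<open>F' = (x F)' F\<close> and
  \<open>L\<^sub>i' = (x L\<^sub>i)' F + p\<^sub>i x\<^sup>i F + (\<Sum>m<i. (m + 1) p\<^sub>m x\<^sup>m L\<^bsub>i-1-m\<^esub>)\<close>.
  The substitution \<open>x = t exp (-t)\<close> turns \<open>F\<close> into \<open>exp t\<close>, and the equation for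
  \<open>G\<^sub>i = exp (-t) L\<^sub>i\<close> becomes an explicit formula for the derivative of \<open>G\<^sub>i\<close>, so that \<open>G\<^sub>i\<close> is a polynomial
  in \<open>t\<close> and \<open>exp (-t)\<close>. By Lagrange inversion the coefficient of \<open>x\<^sup>n\<close> in \<open>L\<^sub>i\<close> is the
  coefficient of \<open>t\<^sup>n\<close> in \<open>G\<^sub>i (1 - t) exp ((n + 1) t)\<close>; each monomial \<open>t\<^sup>a exp (-b t)\<close> of \<open>G\<^sub>i\<close>
  contributes \<open>(a + 1 - b) exp (-b)\<close> to the limit.\<close>

section \<open>Counting parking functions by the spot of the last car\<close>

text \<open>These are the preferences from which a car rolls into \<open>s\<close> over taken spots.
  As \<open>{a..<s}\<close> omits \<open>s\<close>, the sets \<open>S\<close> and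
  \<open>S - {s}\<close> give the same number.\<close>

definition run :: "nat set \<Rightarrow> nat \<Rightarrow> nat" where
  "run S s = card {a \<in> {1..s}. {a..<s} \<subseteq> S}"

text \<open>The number of preference sequences that fill exactly the spots in \<open>S\<close> with all spots in \<open>J\<close>
  lucky; \<open>s\<close> is the spot of the last car, for which \<open>run S s\<close> preferences lead to \<open>s\<close>.\<close>

function fillings :: "nat set \<Rightarrow> nat set \<Rightarrow> nat" where
  "fillings J S = (if finite S \<and> S \<noteq> {}
     then \<Sum>s\<in>S. (if s \<in> J then 1 else run S s) * fillings J (S - {s}) else 1)"
  by pat_completeness auto
termination
  by (relation "Wellfounded.measure (card \<circ> snd)") (auto simp: card_gt_0_iff)

declare fillings.simps [simp del]

lemma fillings_empty [simp]: "fillings J {} = 1"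
  by (simp add: fillings.simps)

lemma fillings_rec:
  "finite S \<Longrightarrow> S \<noteq> {} \<Longrightarrow>
    fillings J S = (\<Sum>s\<in>S. (if s \<in> J then 1 else run S s) * fillings J (S - {s}))"
  by (subst fillings.simps) simp

text \<open>For finite \<open>S\<close>, the length together with the set of outcomes forces every
  car to park and every spot of \<open>S\<close> to be taken exactly once.\<close>

definition parkings :: "nat \<Rightarrow> nat set \<Rightarrow> nat set \<Rightarrow> nat list set" where
  "parkings n J S = {as. length as = card S \<and> set as \<subseteq> {1..n} \<and>
     set (park_outcome n {} as) = Some ` S \<and>
     (\<forall>i<length as. \<forall>j\<in>J. park_outcome n {} as ! i = Some j \<longrightarrow> as ! i = j)}"

section \<open>Removing the last car from a list of preferences\<close>

lemma length_park_outcome [simp]: "length (park_outcome n occ as) = length as"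
  by (induction as arbitrary: occ) (auto simp: Let_def)

lemma park_outcome_snoc:
  "park_outcome n occ (as @ [a]) = park_outcome n occ as @
     [park_spot n (occ \<union> {s. Some s \<in> set (park_outcome n occ as)}) a]"
proof (induction as arbitrary: occ)
  case (Cons b as)
  have "occ \<union> set_option r \<union> {s. Some s \<in> A} = occ \<union> {s. r = Some s \<or> Some s \<in> A}"
    for r and A :: "nat option set"
    by (cases r) auto
  then show ?case
    by (simp add: Let_def Cons eq_commute)
qed simp

lemma park_spot_eq_Some_iff:
  "park_spot n T a = Some s \<longleftrightarrow> a \<le> s \<and> s \<le> n \<and> s \<notin> T \<and> {a..<s} \<subseteq> T"
proof -
  let ?A = "{s \<in> {a..n}. s \<notin> T}"
  have "finite ?A" by simp
  have "park_spot n T a = Some s \<longleftrightarrow> ?A \<noteq> {} \<and> Min ?A = s"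
    by (simp add: park_spot_def Let_def)
  also have "\<dots> \<longleftrightarrow> s \<in> ?A \<and> (\<forall>x\<in>?A. s \<le> x)"
    using Min_eq_iff[OF \<open>finite ?A\<close>, of s] by blast
  also have "\<dots> \<longleftrightarrow> a \<le> s \<and> s \<le> n \<and> s \<notin> T \<and> {a..<s} \<subseteq> T"
    by (fastforce simp: not_less[symmetric])
  finally show ?thesis .
qed

lemma park_spot_notin: "park_spot n T a = Some s \<Longrightarrow> s \<notin> T"
  by (simp add: park_spot_eq_Some_iff)

text \<open>The last car parks in some \<open>s\<close> of \<open>S\<close>, and the earlier cars
  fill \<open>S - {s}\<close>. The luck condition splits into one for the earlier cars and one for
  the last.\<close>

lemma parkings_rec:
  assumes "finite S" "S \<noteq> {}"
  shows "parkings n J S = (\<Union>s\<in>S. (\<lambda>(as, a). as @ [a]) ` (parkings n J (S - {s}) \<times>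
    {a \<in> {1..n}. park_spot n (S - {s}) a = Some s \<and> (s \<in> J \<longrightarrow> a = s)}))" (is "?L = ?R")
proof (intro equalityI subsetI)
  fix xs assume xs: "xs \<in> ?L"
  then have "length xs = card S" by (simp add: parkings_def)
  with assms have "xs \<noteq> []" by auto
  then obtain as a where [simp]: "xs = as @ [a]" by (metis rev_exhaust)
  define T where "T = {s. Some s \<in> set (park_outcome n {} as)}"
  have out: "park_outcome n {} (as @ [a]) = park_outcome n {} as @ [park_spot n T a]"
    by (simp add: park_outcome_snoc T_def)
  from xs have set: "insert (park_spot n T a) (set (park_outcome n {} as)) = Some ` S"
    by (auto simp: parkings_def out)
  then obtain s where s: "s \<in> S" "park_spot n T a = Some s" by blast
  \<comment> \<open>A car never enters a taken spot, so \<open>s\<close> is not among the earlier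
    outcomes, which therefore fill exactly \<open>S - {s}\<close>.\<close>
  then have "s \<notin> T" by (auto dest: park_spot_notin)
  have S: "set (park_outcome n {} as) = Some ` (S - {s})"
    using set s \<open>s \<notin> T\<close> by (auto simp: T_def)
  then have T: "T = S - {s}" by (auto simp: T_def)
  have lucky: "(as @ [a]) ! i = j"
    if "i < length (as @ [a])" "j \<in> J" "park_outcome n {} (as @ [a]) ! i = Some j" for i j
    using xs that by (simp add: parkings_def)
  have "\<forall>i<length as. \<forall>j\<in>J. park_outcome n {} as ! i = Some j \<longrightarrow> as ! i = j"
    using lucky by (auto simp: out nth_append) (metis less_SucI)
  moreover have "s \<in> J \<longrightarrow> a = s"
    using lucky[of "length as" s] s by (simp add: out nth_append)
  moreover have "length as = card (S - {s})"
    using \<open>length xs = card S\<close> s by (simp add: assms)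
  ultimately have "as \<in> parkings n J (S - {s})"
    using xs S by (simp add: parkings_def)
  moreover have "a \<in> {1..n}" using xs by (simp add: parkings_def)
  ultimately have "(as, a) \<in> parkings n J (S - {s}) \<times>
      {a \<in> {1..n}. park_spot n (S - {s}) a = Some s \<and> (s \<in> J \<longrightarrow> a = s)}"
    using s \<open>s \<in> J \<longrightarrow> a = s\<close> by (simp add: T)
  then have "xs \<in> (\<lambda>(as, a). as @ [a]) ` (parkings n J (S - {s}) \<times>
      {a \<in> {1..n}. park_spot n (S - {s}) a = Some s \<and> (s \<in> J \<longrightarrow> a = s)})"
    by (rule rev_image_eqI) simp
  with s show "xs \<in> ?R" by blast
next
  fix xs assume "xs \<in> ?R"
  then obtain s as a where s: "s \<in> S" and [simp]: "xs = as @ [a]" and as: "as \<in> parkings n J (S - {s})"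
    and a: "a \<in> {1..n}" "park_spot n (S - {s}) a = Some s" "s \<in> J \<longrightarrow> a = s" by auto
  have "{s. Some s \<in> set (park_outcome n {} as)} = S - {s}"
    using as by (auto simp: parkings_def)
  then have out: "park_outcome n {} (as @ [a]) = park_outcome n {} as @ [Some s]"
    using a by (simp add: park_outcome_snoc)
  have "length xs = card S"
    using as s assms card_gt_0_iff[of S] by (auto simp: parkings_def)
  moreover have "\<forall>i<length xs. \<forall>j\<in>J. park_outcome n {} xs ! i = Some j \<longrightarrow> xs ! i = j"
    using as a by (auto simp: out parkings_def nth_append less_Suc_eq)
  moreover have "set (park_outcome n {} xs) = Some ` S"
    using as s by (auto simp: out parkings_def)
  ultimately show "xs \<in> ?L"
    using as a by (auto simp: parkings_def)
qed

lemma card_last_preferences: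
  assumes "s \<in> {1..n}" "s \<in> S"
  shows "card {a \<in> {1..n}. park_spot n (S - {s}) a = Some s \<and> (s \<in> J \<longrightarrow> a = s)} =
    (if s \<in> J then 1 else run S s)"
proof (cases "s \<in> J")
  case True
  then have "{a \<in> {1..n}. park_spot n (S - {s}) a = Some s \<and> (s \<in> J \<longrightarrow> a = s)} = {s}"
    using assms by (auto simp: park_spot_eq_Some_iff)
  with True show ?thesis by simp
next
  case False
  then have "{a \<in> {1..n}. park_spot n (S - {s}) a = Some s \<and> (s \<in> J \<longrightarrow> a = s)} =
      {a \<in> {1..s}. {a..<s} \<subseteq> S}"
    using assms by (auto simp: park_spot_eq_Some_iff)
  with False show ?thesis by (simp add: run_def)
qed

lemma finite_parkings: "finite (parkings n J S)"
  by (rule finite_subset[OF _ finite_lists_length_eq[of "{1..n}" "card S"]]) (auto simp: parkings_def)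

text \<open>Counting the decomposition \<open>parkings_rec\<close> gives the recursion that defines
  \<open>fillings\<close>; in particular \<open>n\<close> does not enter the count.\<close>

lemma card_parkings:
  assumes "S \<subseteq> {1..n}"
  shows "card (parkings n J S) = fillings J S"
proof -
  have "finite S" using assms finite_subset by blast
  then show ?thesis using assms
  proof (induction S rule: finite_psubset_induct)
    case (psubset S)
    show ?case
    proof (cases "S = {}")
      case True
      then have "parkings n J S = {[]}" by (auto simp: parkings_def)
      with True show ?thesis by simp
    next
      case False
      let ?C = "\<lambda>s. {a \<in> {1..n}. park_spot n (S - {s}) a = Some s \<and> (s \<in> J \<longrightarrow> a = s)}"
      let ?B = "\<lambda>s. (\<lambda>(as, a). as @ [a]) ` (parkings n J (S - {s}) \<times> ?C s)"
      have card: "card (?B s) = (if s \<in> J then 1 else run S s) * fillings J (S - {s})" if "s \<in> S" for s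
      proof -
        have "card (?B s) = card (parkings n J (S - {s})) * card (?C s)"
          by (subst card_image) (auto simp: inj_on_def card_cartesian_product)
        then show ?thesis
          using psubset.IH[of "S - {s}"] psubset.prems that
          by (subst (asm) card_last_preferences) (auto simp: subset_iff)
      qed
      \<comment> \<open>The spot \<open>t\<close> is taken before the last car arrives in the first
        set and still free in the second, so no prefix is common to both.\<close>
      have disj: "?B s \<inter> ?B t = {}" if "s \<in> S" "t \<in> S" "s \<noteq> t" for s t
      proof -
        have "Some t \<in> set (park_outcome n {} as)" if "as \<in> parkings n J (S - {s})" for as
          using that \<open>t \<in> S\<close> \<open>s \<noteq> t\<close> by (simp add: parkings_def)
        moreover have "Some t \<notin> set (park_outcome n {} as)" if "as \<in> parkings n J (S - {t})" for as
          using that by (auto simp: parkings_def)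
        ultimately have "parkings n J (S - {s}) \<inter> parkings n J (S - {t}) = {}" by blast
        then show ?thesis by auto
      qed
      have "card (parkings n J S) = (\<Sum>s\<in>S. card (?B s))"
        unfolding parkings_rec[OF psubset.hyps False]
        by (rule card_UN_disjoint) (use psubset.hyps disj finite_parkings in auto)
      also have "\<dots> = fillings J S"
        using card by (simp add: fillings_rec[OF psubset.hyps False])
      finally show ?thesis .
    qed
  qed
qed

section \<open>Parking functions with a prescribed lucky spot\<close>

lemma park_outcome_distinct:
  assumes "None \<notin> set (park_outcome n {} as)"
  shows "distinct (park_outcome n {} as)"
  using assms
proof (induction as rule: rev_induct)
  case (snoc a as)
  then show ?case
    by (cases "park_spot n {s. Some s \<in> set (park_outcome n {} as)} a")
      (auto simp: park_outcome_snoc dest: park_spot_notin)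
qed simp

lemma park_outcome_range:
  assumes "set as \<subseteq> {1..n}" "Some s \<in> set (park_outcome n occ as)"
  shows "s \<in> {1..n}"
  using assms
  by (induction as arbitrary: occ) (auto simp: Let_def park_spot_eq_Some_iff eq_commute[of "Some s"])

text \<open>If no car fails, the \<open>n\<close> outcomes are distinct and lie in a set of
  \<open>n\<close> elements, so they exhaust it.\<close>

lemma parking_functions_iff:
  "as \<in> parking_functions n \<longleftrightarrow>
     length as = n \<and> set as \<subseteq> {1..n} \<and> set (park_outcome n {} as) = Some ` {1..n}"
proof (cases "length as = n \<and> set as \<subseteq> {1..n} \<and> None \<notin> set (park_outcome n {} as)")
  case True
  have "set (park_outcome n {} as) \<subseteq> Some ` {1..n}"
  proof
    fix x assume "x \<in> set (park_outcome n {} as)"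
    with True park_outcome_range[of as n] show "x \<in> Some ` {1..n}"
      by (cases x) auto
  qed
  moreover have "card (set (park_outcome n {} as)) = card (Some ` {1..n})"
    using True park_outcome_distinct[of n as] by (simp add: distinct_card card_image)
  ultimately have "set (park_outcome n {} as) = Some ` {1..n}"
    by (intro card_subset_eq) auto
  with True show ?thesis by (simp add: parking_functions_def)
qed (auto simp: parking_functions_def)

text \<open>Only one car parks in spot \<open>j\<close>, so the sets counted for different cars are
  disjoint. Their union consists of the parking functions with \<open>j\<close> lucky.\<close>

lemma sum_q:
  assumes "j \<in> {1..n}"
  shows "(\<Sum>i = 1..n. q n i j) = fillings {j} {1..n}"
proof -
  let ?Q = "\<lambda>i. {as \<in> parking_functions n. car_pref as i = j \<and> lucky_car n as i}"
  have fin: "finite (?Q i)" for i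
    by (rule finite_subset[OF _ finite_lists_length_eq[of "{1..n}" n]])
      (auto simp: parking_functions_def)
  have dist: "distinct (park_outcome n {} as)" if "as \<in> parking_functions n" for as
    using that park_outcome_distinct by (simp add: parking_functions_def)
  have disj: "?Q i \<inter> ?Q k = {}" if "i \<in> {1..n}" "k \<in> {1..n}" "i \<noteq> k" for i k
  proof -
    have False if "as \<in> ?Q i" "as \<in> ?Q k" for as
    proof -
      have "park_outcome n {} as ! (i - 1) = park_outcome n {} as ! (k - 1)"
        using that by (simp add: lucky_car_def)
      moreover have "i - 1 < length as" "k - 1 < length as" "i - 1 \<noteq> k - 1"
        using that \<open>i \<in> {1..n}\<close> \<open>k \<in> {1..n}\<close> \<open>i \<noteq> k\<close> by (auto simp: parking_functions_iff)
      ultimately show False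
        using dist[of as] that by (auto simp: nth_eq_iff_index_eq)
    qed
    then show ?thesis by blast
  qed
  have "(\<Sum>i = 1..n. q n i j) = card (\<Union>i\<in>{1..n}. ?Q i)"
    unfolding q_def by (rule card_UN_disjoint[symmetric]) (use fin disj in auto)
  also have "(\<Union>i\<in>{1..n}. ?Q i) = parkings n {j} {1..n}"
  proof (intro equalityI subsetI)
    fix as assume "as \<in> (\<Union>i\<in>{1..n}. ?Q i)"
    then obtain i where i: "i \<in> {1..n}" "as \<in> ?Q i" by blast
    then have pf: "as \<in> parking_functions n" and len: "length as = n"
      by (auto simp: parking_functions_def)
    have "as ! k = j" if "k < n" "park_outcome n {} as ! k = Some j" for k
    proof -
      have "park_outcome n {} as ! k = park_outcome n {} as ! (i - 1)"
        using that i by (simp add: lucky_car_def)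
      then have "k = i - 1"
        using that i dist[OF pf] by (subst (asm) nth_eq_iff_index_eq) (auto simp: len)
      then show ?thesis using i by (simp add: car_pref_def)
    qed
    with pf show "as \<in> parkings n {j} {1..n}"
      by (simp add: parkings_def parking_functions_iff)
  next
    fix as assume as: "as \<in> parkings n {j} {1..n}"
    then have "Some j \<in> set (park_outcome n {} as)"
      using assms by (simp add: parkings_def)
    then obtain k where k: "k < length as" "park_outcome n {} as ! k = Some j"
      by (auto simp: in_set_conv_nth)
    then have "as ! k = j" "length as = n" using as by (auto simp: parkings_def)
    then have "as \<in> ?Q (Suc k)" "Suc k \<in> {1..n}"
      using k as by (auto simp: car_pref_def lucky_car_def parkings_def parking_functions_iff)
    then show "as \<in> (\<Union>i\<in>{1..n}. ?Q i)" by blast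
  qed
  also have "card \<dots> = fillings {j} {1..n}"
    by (simp add: card_parkings)
  finally show ?thesis .
qed

section \<open>Splitting the street at one spot\<close>

lemma run_cong_left:
  assumes "s \<in> A" "m \<notin> A" "\<And>x. x \<in> A \<Longrightarrow> x < m" "\<And>x. x \<in> B \<Longrightarrow> m < x"
  shows "run (A \<union> B) s = run A s"
  unfolding run_def using assms by (intro arg_cong[of _ _ card]) (fastforce simp: subset_iff)

lemma run_cong_right:
  assumes "s \<in> B" "\<And>x. x \<in> A \<Longrightarrow> x < m" "\<And>x. x \<in> B \<Longrightarrow> m < x"
  shows "run (A \<union> B) s = run B s"
proof -
  have "{a..<s} \<subseteq> A \<union> B \<longleftrightarrow> {a..<s} \<subseteq> B" for a
  proof
    assume *: "{a..<s} \<subseteq> A \<union> B"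
    \<comment> \<open>A run reaching back to some \<open>a\<close> \<le> \<open>m\<close> would
      contain the empty spot \<open>m\<close>.\<close>
    have "m < s" "m \<notin> A \<union> B" using assms by auto
    with * have "\<not> a \<le> m" by (metis atLeastLessThan_iff subset_iff)
    with * assms show "{a..<s} \<subseteq> B" by fastforce
  qed auto
  then show ?thesis by (simp add: run_def)
qed

text \<open>The empty spot \<open>m\<close> keeps the cars on its two sides from interfering, so a
  filling of the union is an interleaving of a filling of \<open>A\<close> and one of
  \<open>B\<close>. The binomial coefficient counts the interleavings.\<close>

lemma fillings_Un:
  assumes "finite A" "finite B" "\<And>x. x \<in> A \<Longrightarrow> x < m" "\<And>x. x \<in> B \<Longrightarrow> m < x"
  shows "fillings J (A \<union> B) = (card A + card B choose card A) * (fillings J A * fillings J B)"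
  using assms
proof (induction "card A + card B" arbitrary: A B rule: less_induct)
  case less
  let ?w = "\<lambda>S s. if s \<in> J then 1 else run S s"
  have disj: "A \<inter> B = {}" using less.prems by fastforce
  show ?case
  proof (cases "A = {} \<or> B = {}")
    case False
    then have pos: "card A > 0" "card B > 0" using less.prems by (auto simp: card_gt_0_iff)
    define a b where "a = card A - 1" and "b = card B - 1"
    have ab: "card A = Suc a" "card B = Suc b" using pos by (auto simp: a_def b_def)
    have "fillings J (A \<union> B) = (\<Sum>s\<in>A. ?w (A \<union> B) s * fillings J (A \<union> B - {s})) +
        (\<Sum>s\<in>B. ?w (A \<union> B) s * fillings J (A \<union> B - {s}))"
      using less.prems False disj by (simp add: fillings_rec sum.union_disjoint)
    also have "(\<Sum>s\<in>A. ?w (A \<union> B) s * fillings J (A \<union> B - {s})) =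
        (\<Sum>s\<in>A. (a + Suc b choose a) * fillings J B * (?w A s * fillings J (A - {s})))"
    proof (rule sum.cong[OF refl])
      fix s assume s: "s \<in> A"
      then have "A \<union> B - {s} = (A - {s}) \<union> B" using disj by auto
      moreover have "fillings J ((A - {s}) \<union> B) =
          (a + Suc b choose a) * (fillings J (A - {s}) * fillings J B)"
        using less.hyps[of "A - {s}" B] less.prems s ab by simp
      moreover have "run (A \<union> B) s = run A s"
        using less.prems s by (intro run_cong_left[of _ _ m]) auto
      ultimately show "?w (A \<union> B) s * fillings J (A \<union> B - {s}) =
          (a + Suc b choose a) * fillings J B * (?w A s * fillings J (A - {s}))"
        by simp
    qed
    also have "\<dots> = (a + Suc b choose a) * (fillings J A * fillings J B)"
      using less.prems False by (simp add: fillings_rec[of A] flip: sum_distrib_left)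
    also have "(\<Sum>s\<in>B. ?w (A \<union> B) s * fillings J (A \<union> B - {s})) =
        (\<Sum>s\<in>B. (Suc a + b choose Suc a) * fillings J A * (?w B s * fillings J (B - {s})))"
    proof (rule sum.cong[OF refl])
      fix s assume s: "s \<in> B"
      then have "A \<union> B - {s} = A \<union> (B - {s})" using disj by auto
      moreover have "fillings J (A \<union> (B - {s})) =
          (Suc a + b choose Suc a) * (fillings J A * fillings J (B - {s}))"
        using less.hyps[of A "B - {s}"] less.prems s ab by simp
      moreover have "run (A \<union> B) s = run B s"
        using less.prems s by (intro run_cong_right[of _ _ _ m]) auto
      ultimately show "?w (A \<union> B) s * fillings J (A \<union> B - {s}) =
          (Suc a + b choose Suc a) * fillings J A * (?w B s * fillings J (B - {s}))"
        by simp
    qed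
    also have "\<dots> = (Suc a + b choose Suc a) * (fillings J A * fillings J B)"
      using less.prems False by (simp add: fillings_rec[of B] flip: sum_distrib_left)
    \<comment> \<open>The last car lies in \<open>A\<close> or in \<open>B\<close>; the two binomial
      coefficients add up by Pascal's rule.\<close>
    finally show ?thesis
      by (simp add: ab add_mult_distrib)
  qed auto
qed

lemma fillings_cong:
  assumes "J \<inter> S = J' \<inter> S"
  shows "fillings J S = fillings J' S"
proof (cases "finite S")
  case True
  then show ?thesis using assms
  proof (induction S rule: finite_psubset_induct)
    case (psubset S)
    have "(if s \<in> J then 1 else run S s) * fillings J (S - {s}) =
        (if s \<in> J' then 1 else run S s) * fillings J' (S - {s})" if "s \<in> S" for s
    proof -
      have "s \<in> J \<longleftrightarrow> s \<in> J'" "J \<inter> (S - {s}) = J' \<inter> (S - {s})" using psubset.prems that by auto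
      moreover have "S - {s} \<subset> S" using that by auto
      ultimately show ?thesis using psubset.IH[of "S - {s}"] by simp
    qed
    then show ?case
      using psubset.hyps by (cases "S = {}") (auto simp: fillings_rec)
  qed
qed (simp add: fillings.simps)

lemma run_shift:
  assumes "s \<in> S" "0 \<notin> S"
  shows "run ((+) m ` S) (m + s) = run S s"
proof -
  have "{a \<in> {1..m + s}. {a..<m + s} \<subseteq> (+) m ` S} = (+) m ` {a \<in> {1..s}. {a..<s} \<subseteq> S}"
  proof (intro equalityI subsetI)
    fix a assume a: "a \<in> {a \<in> {1..m + s}. {a..<m + s} \<subseteq> (+) m ` S}"
    have "s > 0" using assms by (cases s) auto
    \<comment> \<open>Otherwise \<open>{a..<m + s}\<close> would contain \<open>m\<close>, and
      \<open>0\<close> would lie in \<open>S\<close>.\<close>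
    have "m < a"
    proof (rule ccontr)
      assume "\<not> m < a"
      with a \<open>s > 0\<close> have "m \<in> (+) m ` S" by (auto simp: subset_iff)
      with assms show False by auto
    qed
    then obtain b where b: "a = m + b" "b > 0" using less_imp_add_positive by blast
    have "{b..<s} \<subseteq> S"
    proof
      fix x assume "x \<in> {b..<s}"
      then have "m + x \<in> {a..<m + s}" using b by simp
      then have "m + x \<in> (+) m ` S" using a by blast
      then show "x \<in> S" by auto
    qed
    with a b show "a \<in> (+) m ` {a \<in> {1..s}. {a..<s} \<subseteq> S}" by auto
  next
    fix a assume "a \<in> (+) m ` {a \<in> {1..s}. {a..<s} \<subseteq> S}"
    then obtain b where "a = m + b" "b \<in> {1..s}" "{b..<s} \<subseteq> S" by blast
    moreover have "{a..<m + s} = (+) m ` {b..<s}"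
      using \<open>a = m + b\<close> by (simp add: add.commute)
    ultimately have "{a..<m + s} \<subseteq> (+) m ` S" "a \<in> {1..m + s}"
      by (simp_all only: image_mono) simp
    then show "a \<in> {a \<in> {1..m + s}. {a..<m + s} \<subseteq> (+) m ` S}" by simp
  qed
  then show ?thesis by (simp add: run_def card_image)
qed

lemma fillings_shift:
  assumes "finite S" "0 \<notin> S"
  shows "fillings J ((+) m ` S) = fillings {s. m + s \<in> J} S"
  using assms
proof (induction S rule: finite_psubset_induct)
  case (psubset S)
  show ?case
  proof (cases "S = {}")
    case False
    have "fillings J ((+) m ` S) = (\<Sum>s\<in>S. (if m + s \<in> J then 1 else run ((+) m ` S) (m + s)) *
        fillings J ((+) m ` S - {m + s}))"
      using psubset.hyps False by (simp add: fillings_rec sum.reindex)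
    also have "\<dots> = (\<Sum>s\<in>S. (if m + s \<in> J then 1 else run S s) * fillings {s. m + s \<in> J} (S - {s}))"
    proof (rule sum.cong[OF refl])
      fix s assume s: "s \<in> S"
      have "(+) m ` S - {m + s} = (+) m ` (S - {s})" by auto
      moreover have "S - {s} \<subset> S" using s by auto
      ultimately show "(if m + s \<in> J then 1 else run ((+) m ` S) (m + s)) * fillings J ((+) m ` S - {m + s}) =
         (if m + s \<in> J then 1 else run S s) * fillings {s. m + s \<in> J} (S - {s})"
        using psubset.IH[of "S - {s}"] psubset.prems s by (simp add: run_shift)
    qed
    also have "\<dots> = fillings {s. m + s \<in> J} S"
      using psubset.hyps False by (simp add: fillings_rec[of S])
    finally show ?thesis .
  qed simp
qed

lemma run_atLeastAtMost: "s \<le> n \<Longrightarrow> run {1..n} s = s"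
proof -
  assume "s \<le> n"
  then have "{a \<in> {1..s}. {a..<s} \<subseteq> {1..n}} = {1..s}" by auto
  then show ?thesis by (simp add: run_def)
qed

text \<open>The last car parks in \<open>Suc m\<close>. Before that, \<open>m\<close> spots on the
  left and \<open>n - m\<close> on the right have been filled independently; the right block is
  relabelled from 1, which shifts \<open>J\<close>.\<close>

lemma fillings_Suc:
  "fillings J {1..Suc n} = (\<Sum>m\<le>n. (n choose m) * (if Suc m \<in> J then 1 else Suc m) *
     fillings J {1..m} * fillings {s. Suc m + s \<in> J} {1..n - m})"
proof -
  have set: "{1..Suc n} = Suc ` {..n}"
    by (simp add: image_Suc_atMost)
  have "fillings J {1..Suc n} = (\<Sum>s\<in>{1..Suc n}. (if s \<in> J then 1 else run {1..Suc n} s) *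
      fillings J ({1..Suc n} - {s}))"
    by (rule fillings_rec) auto
  also have "\<dots> = (\<Sum>s\<in>{1..Suc n}. (if s \<in> J then 1 else s) * fillings J ({1..Suc n} - {s}))"
    by (rule sum.cong[OF refl], subst run_atLeastAtMost) simp_all
  also have "\<dots> = (\<Sum>s\<in>Suc ` {..n}. (if s \<in> J then 1 else s) * fillings J ({1..Suc n} - {s}))"
    by (simp only: set)
  also have "\<dots> = (\<Sum>m\<le>n. (if Suc m \<in> J then 1 else Suc m) * fillings J ({1..Suc n} - {Suc m}))"
    by (simp only: sum.reindex[OF inj_Suc] o_def)
  also have "\<dots> = (\<Sum>m\<le>n. (n choose m) * (if Suc m \<in> J then 1 else Suc m) *
     fillings J {1..m} * fillings {s. Suc m + s \<in> J} {1..n - m})"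
  proof (rule sum.cong[OF refl])
    fix m assume m: "m \<in> {..n}"
    have shift: "(+) (Suc m) ` {1..n - m} = {Suc m + 1..Suc m + (n - m)}"
      by (simp only: image_add_atLeastAtMost) (simp add: add.commute)
    have "{1..Suc n} - {Suc m} = {1..m} \<union> (+) (Suc m) ` {1..n - m}"
      unfolding shift using m by auto
    moreover have "fillings J ({1..m} \<union> (+) (Suc m) ` {1..n - m}) =
        (card {1..m} + card ((+) (Suc m) ` {1..n - m}) choose card {1..m}) *
        (fillings J {1..m} * fillings J ((+) (Suc m) ` {1..n - m}))"
      by (rule fillings_Un[of _ _ "Suc m"]) auto
    moreover have "card ((+) (Suc m) ` {1..n - m}) = n - m"
      unfolding shift by simp
    moreover have "fillings J ((+) (Suc m) ` {1..n - m}) = fillings {s. Suc m + s \<in> J} {1..n - m}"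
      by (rule fillings_shift) auto
    ultimately show "(if Suc m \<in> J then 1 else Suc m) * fillings J ({1..Suc n} - {Suc m}) =
      (n choose m) * (if Suc m \<in> J then 1 else Suc m) *
     fillings J {1..m} * fillings {s. Suc m + s \<in> J} {1..n - m}"
      using m by simp
  qed
  finally show ?thesis .
qed

section \<open>Generating functions\<close>

abbreviation E :: "real fps" where
  "E \<equiv> fps_exp (-1)"

abbreviation W :: "real fps" where
  "W \<equiv> fps_X * E"

lemma exp_1_mult_E [simp]: "fps_exp 1 * E = (1 :: real fps)" "E * fps_exp 1 = (1 :: real fps)"
  by (simp_all flip: fps_exp_add_mult)

lemma E_power: "E ^ b = fps_exp (- real b)"
  by (simp add: fps_exp_power_mult)

lemma deriv_E: "fps_deriv E = - E"
  by (simp add: fps_eq_iff)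

lemma deriv_W: "fps_deriv W = (1 - fps_X) * E"
  by (simp add: deriv_E algebra_simps del: fps_exp_deriv)

text \<open>By linearity it suffices to take \<open>f = x\<^sup>k\<close>, where the right-hand side is the coefficient of
  \<open>t\<^bsup>n-k\<^esup>\<close> in \<open>(1 - t) exp ((n - k) t)\<close>.\<close>

lemma lagrange_coeff:
  fixes f :: "real fps"
  shows "fps_nth f n = fps_nth ((f oo W) * (1 - fps_X) * fps_exp (real n)) n"
proof -
  have power: "fps_nth (W ^ k * ((1 - fps_X) * fps_exp (real n))) n = (if k = n then 1 else 0)"
    if "k \<le> n" for k
  proof -
    have "W ^ k * ((1 - fps_X) * fps_exp (real n)) =
        fps_X ^ k * ((1 - fps_X) * (E ^ k * fps_exp (real n)))"
      by (simp add: power_mult_distrib mult_ac)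
    also have "E ^ k * fps_exp (real n) = fps_exp (real (n - k))"
      using that by (simp add: E_power of_nat_diff flip: fps_exp_add_mult)
    finally have "W ^ k * ((1 - fps_X) * fps_exp (real n)) =
        fps_X ^ k * ((1 - fps_X) * fps_exp (real (n - k)))" .
    then have *: "fps_nth (W ^ k * ((1 - fps_X) * fps_exp (real n))) n =
        fps_nth ((1 - fps_X) * fps_exp (real (n - k))) (n - k)"
      using that by (simp only: fps_X_power_mult_nth) simp
    show ?thesis
    proof (cases "n - k")
      case 0
      with that * show ?thesis by simp
    next
      case (Suc m)
      \<comment> \<open>For \<open>n - k > 0\<close> the two terms of the coefficient are equal and
        cancel.\<close>
      then have "real (n - k) ^ Suc m / fact (Suc m) = real (n - k) ^ m / fact m"
        by (simp add: Suc del: of_nat_Suc)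
      with Suc * show ?thesis by (simp add: algebra_simps)
    qed
  qed
  let ?h = "(1 - fps_X) * fps_exp (real n)"
  \<comment> \<open>\<open>W ^ k\<close> starts at degree \<open>k\<close>, so the inner sum over
    \<open>k\<close> \<le> \<open>i\<close> can be extended to \<open>k\<close> \<le>
    \<open>n\<close> and the two sums exchanged.\<close>
  have W0: "fps_nth (W ^ k) i = 0" if "i < k" for i k
    using that by (simp add: power_mult_distrib fps_X_power_mult_nth)
  have "fps_nth ((f oo W) * ?h) n = (\<Sum>i\<le>n. (\<Sum>k\<le>i. fps_nth f k * fps_nth (W ^ k) i) * fps_nth ?h (n - i))"
    by (simp only: fps_mult_nth[of "f oo W"] fps_compose_nth atLeast0AtMost)
  also have "\<dots> = (\<Sum>i\<le>n. \<Sum>k\<le>n. fps_nth f k * (fps_nth (W ^ k) i * fps_nth ?h (n - i)))"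
  proof (rule sum.cong[OF refl])
    fix i assume "i \<in> {..n}"
    then have "(\<Sum>k\<le>i. fps_nth f k * fps_nth (W ^ k) i) = (\<Sum>k\<le>n. fps_nth f k * fps_nth (W ^ k) i)"
      by (intro sum.mono_neutral_left) (use W0 in auto)
    then show "(\<Sum>k\<le>i. fps_nth f k * fps_nth (W ^ k) i) * fps_nth ?h (n - i) =
        (\<Sum>k\<le>n. fps_nth f k * (fps_nth (W ^ k) i * fps_nth ?h (n - i)))"
      by (simp only: sum_distrib_right mult.assoc)
  qed
  also have "\<dots> = (\<Sum>k\<le>n. fps_nth f k * fps_nth (W ^ k * ?h) n)"
    by (subst sum.swap) (simp only: fps_mult_nth[of "W ^ _"] atLeast0AtMost sum_distrib_left)
  also have "\<dots> = (\<Sum>k\<le>n. if k = n then fps_nth f k else 0)"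
    by (rule sum.cong) (use power in auto)
  also have "\<dots> = fps_nth f n"
    by simp
  finally show ?thesis by (simp only: mult.assoc)
qed

lemma fps_linear_ode_unique:
  fixes u c :: "real fps"
  assumes "fps_deriv u = c * u" "fps_nth u 0 = 0"
  shows "u = 0"
proof -
  have "fps_nth u n = 0" for n
  proof (induction n rule: less_induct)
    case (less n)
    show ?case
    proof (cases n)
      case 0
      with assms show ?thesis by simp
    next
      case (Suc m)
      have "real (Suc m) * fps_nth u (Suc m) = fps_nth (c * u) m"
        using arg_cong[OF assms(1), of "\<lambda>f. fps_nth f m"] by simp
      also have "\<dots> = 0"
        unfolding fps_mult_nth by (rule sum.neutral) (use less Suc in auto)
      finally show ?thesis using Suc by simp
    qed
  qed
  then show ?thesis by (simp add: fps_eq_iff)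
qed

section \<open>Exponential generating functions and their differential equations\<close>

definition park_fps :: "real fps" where
  "park_fps = Abs_fps (\<lambda>n. real (fillings {} {1..n}) / fact n)"

text \<open>For \<open>n\<close> \<le> \<open>i\<close> the spot \<open>Suc i\<close> does not
  exist, and \<open>fillings\<close> would count all parking functions; the cutoff replaces this by
  0.\<close>

definition lucky_fps :: "nat \<Rightarrow> real fps" where
  "lucky_fps i = Abs_fps (\<lambda>n. if i < n then real (fillings {Suc i} {1..n}) / fact n else 0)"

lemma nth_park_fps: "fps_nth park_fps n = real (fillings {} {1..n}) / fact n"
  by (simp add: park_fps_def)

lemma nth_lucky_fps: "i < n \<Longrightarrow> fps_nth (lucky_fps i) n = real (fillings {Suc i} {1..n}) / fact n"
  by (simp add: lucky_fps_def)

lemma nth_lucky_fps_eq_0: "n \<le> i \<Longrightarrow> fps_nth (lucky_fps i) n = 0"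
  by (simp add: lucky_fps_def)

lemma real_binomial_div_fact:
  "m \<le> n \<Longrightarrow> real (n choose m) / fact n = 1 / (fact m * fact (n - m))"
  by (simp add: binomial_fact field_simps)

lemma nth_deriv_X_mult:
  "fps_nth (fps_deriv (fps_X * f)) m = real (Suc m) * fps_nth f m"
  for f :: "real fps"
  by (simp add: algebra_simps)

text \<open>In \<open>fillings_Suc\<close> the left block and the choice of the last car contribute
  \<open>(m + 1) p_m\<close>, a coefficient of \<open>(x F)'\<close>; the right block contributes a
  coefficient of \<open>F\<close>.\<close>

lemma deriv_park_fps: "fps_deriv park_fps = fps_deriv (fps_X * park_fps) * park_fps"
proof (rule fps_ext)
  fix n
  have "fps_nth (fps_deriv park_fps) n = real (fillings {} {1..Suc n}) / fact n"
    by (simp add: nth_park_fps field_simps del: of_nat_Suc)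
  also have "\<dots> = (\<Sum>m\<le>n. real (n choose m) / fact n *
      (real (Suc m) * fillings {} {1..m} * fillings {} {1..n - m}))"
    by (simp add: fillings_Suc sum_divide_distrib mult_ac del: of_nat_Suc One_nat_def mult_Suc mult_Suc_right)
  also have "\<dots> = (\<Sum>m\<le>n. real (Suc m) * fps_nth park_fps m * fps_nth park_fps (n - m))"
    by (rule sum.cong) (auto simp: real_binomial_div_fact nth_park_fps simp del: of_nat_Suc)
  also have "\<dots> = fps_nth (fps_deriv (fps_X * park_fps) * park_fps) n"
    by (simp only: fps_mult_nth[of "fps_deriv _"] nth_deriv_X_mult atLeast0AtMost)
  finally show "fps_nth (fps_deriv park_fps) n = \<dots>" .
qed

text \<open>The terms correspond to the last car parking right of, in, or left of the lucky spot
  \<open>Suc i\<close>. In the last case the lucky spot has number \<open>i - m\<close> in the right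
  block, hence the index \<open>i - Suc m\<close>.\<close>

lemma deriv_lucky_fps:
  "fps_deriv (lucky_fps i) = fps_deriv (fps_X * lucky_fps i) * park_fps +
     fps_const (fps_nth park_fps i) * fps_X ^ i * park_fps +
     (\<Sum>m<i. fps_const (real (Suc m) * fps_nth park_fps m) * fps_X ^ m * lucky_fps (i - Suc m))"
proof (rule fps_ext)
  fix n
  let ?g = "\<lambda>m. real (Suc m) * fps_nth (lucky_fps i) m * fps_nth park_fps (n - m) +
      (if m = i then fps_nth park_fps i * fps_nth park_fps (n - i) else 0) +
      (if m < i then real (Suc m) * fps_nth park_fps m * fps_nth (lucky_fps (i - Suc m)) (n - m) else 0)"
  have summand: "real (n choose m) / fact n * (real (if m = i then 1 else Suc m) *
      fillings {Suc i} {1..m} * fillings {s. Suc m + s = Suc i} {1..n - m}) = ?g m"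
    if "m \<le> n" "i \<le> n" for m
  proof -
    consider "m < i" | "m = i" | "i < m" by linarith
    then show ?thesis
    proof cases
      case 1
      have "{s. Suc m + s = Suc i} = {Suc (i - Suc m)}" using 1 by auto
      moreover have "fillings {Suc i} {1..m} = fillings {} {1..m}"
        using 1 by (intro fillings_cong) auto
      moreover have "i - Suc m < n - m" using 1 that by auto
      ultimately show ?thesis using 1 that
        by (simp add: real_binomial_div_fact nth_park_fps nth_lucky_fps nth_lucky_fps_eq_0 del: of_nat_Suc)
    next
      case 2
      have "fillings {s. Suc m + s = Suc i} {1..n - m} = fillings {} {1..n - m}"
        using 2 by (intro fillings_cong) auto
      moreover have "fillings {Suc i} {1..m} = fillings {} {1..m}"
        using 2 by (intro fillings_cong) auto
      ultimately show ?thesis using 2 that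
        by (simp add: real_binomial_div_fact nth_park_fps nth_lucky_fps_eq_0 del: of_nat_Suc)
    next
      case 3
      have "fillings {s. Suc m + s = Suc i} {1..n - m} = fillings {} {1..n - m}"
        using 3 by (intro fillings_cong) auto
      then show ?thesis using 3 that
        by (simp add: real_binomial_div_fact nth_park_fps nth_lucky_fps del: of_nat_Suc)
    qed
  qed
  have "fps_nth (fps_deriv (lucky_fps i)) n = (\<Sum>m\<le>n. ?g m)"
  proof (cases "i \<le> n")
    case True
    then have "fps_nth (fps_deriv (lucky_fps i)) n = real (fillings {Suc i} {1..Suc n}) / fact n"
      by (simp add: nth_lucky_fps field_simps del: of_nat_Suc)
    also have "\<dots> = (\<Sum>m\<le>n. real (n choose m) / fact n * (real (if m = i then 1 else Suc m) *
      fillings {Suc i} {1..m} * fillings {s. Suc m + s = Suc i} {1..n - m}))"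
      by (simp add: fillings_Suc sum_divide_distrib mult_ac del: of_nat_Suc One_nat_def mult_Suc mult_Suc_right)
    also have "\<dots> = (\<Sum>m\<le>n. ?g m)"
      using True summand by (intro sum.cong) auto
    finally show ?thesis .
  next
    \<comment> \<open>For \<open>n < i\<close> the cutoff in \<open>lucky_fps\<close> makes both
      sides vanish.\<close>
    case False
    then have "?g m = 0" if "m \<le> n" for m
      using that by (simp add: nth_lucky_fps_eq_0)
    then show ?thesis using False by (simp add: nth_lucky_fps_eq_0)
  qed
  also have "\<dots> = fps_nth (fps_deriv (fps_X * lucky_fps i) * park_fps) n +
      fps_nth (fps_X ^ i * (fps_const (fps_nth park_fps i) * park_fps)) n +
      (\<Sum>m<i. fps_nth (fps_X ^ m * (fps_const (real (Suc m) * fps_nth park_fps m) * lucky_fps (i - Suc m))) n)"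
  proof -
    have "(\<Sum>m\<le>n. real (Suc m) * fps_nth (lucky_fps i) m * fps_nth park_fps (n - m)) =
        fps_nth (fps_deriv (fps_X * lucky_fps i) * park_fps) n"
      by (simp only: fps_mult_nth[of "fps_deriv _"] nth_deriv_X_mult atLeast0AtMost)
    moreover have "(\<Sum>m\<le>n. if m = i then fps_nth park_fps i * fps_nth park_fps (n - i) else 0) =
        fps_nth (fps_X ^ i * (fps_const (fps_nth park_fps i) * park_fps)) n"
      by (simp add: fps_X_power_mult_nth)
    moreover have "(\<Sum>m\<le>n. if m < i then real (Suc m) * fps_nth park_fps m *
          fps_nth (lucky_fps (i - Suc m)) (n - m) else 0) =
        (\<Sum>m<i. fps_nth (fps_X ^ m * (fps_const (real (Suc m) * fps_nth park_fps m) * lucky_fps (i - Suc m))) n)"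
      unfolding fps_X_power_mult_nth
      by (rule sum.mono_neutral_cong) (auto simp: nth_lucky_fps_eq_0 simp del: of_nat_Suc)
    ultimately show ?thesis by (simp only: sum.distrib)
  qed
  also have "\<dots> = fps_nth (fps_deriv (fps_X * lucky_fps i) * park_fps +
     fps_const (fps_nth park_fps i) * fps_X ^ i * park_fps +
     (\<Sum>m<i. fps_const (real (Suc m) * fps_nth park_fps m) * fps_X ^ m * lucky_fps (i - Suc m))) n"
    by (simp only: fps_add_nth fps_sum_nth mult_ac)
  finally show "fps_nth (fps_deriv (lucky_fps i)) n = \<dots>" .
qed

section \<open>Solving the equations after the substitution\<close>

lemma park_fps_compose_W: "park_fps oo W = fps_exp 1"
proof -
  define Y where "Y = park_fps oo W"
  define D where "D = fps_deriv park_fps oo W"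
  \<comment> \<open>The claim amounts to \<open>Z = 1\<close>.\<close>
  define Z where "Z = Y * E"
  have "D = fps_deriv (fps_X * park_fps) * park_fps oo W"
    by (simp only: D_def flip: deriv_park_fps)
  also have "fps_deriv (fps_X * park_fps) * park_fps = (park_fps + fps_X * fps_deriv park_fps) * park_fps"
    by simp
  also have "\<dots> oo W = (Y + W * D) * Y"
    by (simp add: fps_compose_mult_distrib fps_compose_add_distrib Y_def D_def)
  finally have D: "D = (Y + W * D) * Y" .
  have Y': "fps_deriv Y = D * ((1 - fps_X) * E)"
    unfolding Y_def D_def by (subst fps_compose_deriv) (simp_all only: deriv_W, simp)
  have "Z' * (1 - fps_X * Z) = Z * (Z - 1)" if "Z' = fps_deriv Z" for Z'
  proof -
    have "Z' = D * ((1 - fps_X) * E) * E - Z"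
      unfolding that by (simp add: Z_def Y' deriv_E algebra_simps del: fps_exp_deriv)
    then have "Z' * (1 - fps_X * Z) = (D * ((1 - fps_X) * E) * E - Z) * (1 - fps_X * Z)"
      by simp
    also have "\<dots> = D * (1 - fps_X * Z) * ((1 - fps_X) * E * E) - Z * (1 - fps_X * Z)"
      by (simp add: algebra_simps)
    \<comment> \<open>Since \<open>W * Y = fps_X * Z\<close>, the equation for \<open>D\<close> can
      be solved for the product with \<open>1 - fps_X * Z\<close>; this removes
      \<open>D\<close>.\<close>
    also have "D * (1 - fps_X * Z) = Y * Y"
      using D by (simp add: Z_def algebra_simps)
    finally show ?thesis by (simp add: Z_def algebra_simps)
  qed
  then have ode: "fps_deriv Z * (1 - fps_X * Z) = Z * (Z - 1)" by blast
  \<comment> \<open>The series \<open>1 - fps_X * Z\<close> has constant term 1. Dividing by it and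
    treating \<open>Z / (1 - fps_X * Z)\<close> as a given coefficient makes the equation linear and
    homogeneous in \<open>Z - 1\<close>.\<close>
  have unit: "inverse (1 - fps_X * Z) * (1 - fps_X * Z) = 1"
    by (rule inverse_mult_eq_1) simp
  have "fps_deriv (Z - 1) = inverse (1 - fps_X * Z) * Z * (Z - 1)"
    by (metis (no_types, lifting) ode unit fps_deriv_1 fps_deriv_sub diff_zero mult.commute mult.assoc mult.left_neutral)
  moreover have "fps_nth (Z - 1) 0 = 0"
    by (simp add: Z_def Y_def nth_park_fps)
  ultimately have "Z - 1 = 0" by (rule fps_linear_ode_unique)
  then have "Y * E = 1" by (simp add: Z_def)
  then have "Y * (E * fps_exp 1) = fps_exp 1" by (metis mult.assoc mult.left_neutral)
  then show ?thesis by (simp add: Y_def)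
qed

text \<open>This is \<open>G_i\<close>. After the substitution, \<open>K = lucky_fps i oo W\<close>
  satisfies an equation \<open>K' = K + ...\<close>, for which \<open>E\<close> is the integrating
  factor.\<close>

definition lucky_exp_poly :: "nat \<Rightarrow> real fps" where
  "lucky_exp_poly i = (lucky_fps i oo W) * E"

text \<open>Lagrange inversion, with the additional factor \<open>E\<close> compensated by the
  exponent \<open>n + 1\<close> in place of \<open>n\<close>.\<close>

lemma nth_lucky_fps_eq:
  "fps_nth (lucky_fps i) n = fps_nth (lucky_exp_poly i * (1 - fps_X) * fps_exp (real (Suc n))) n"
proof -
  have "lucky_exp_poly i * (1 - fps_X) * fps_exp (real (Suc n)) =
      (lucky_fps i oo W) * (1 - fps_X) * (E * fps_exp (real (Suc n)))"
    by (simp only: lucky_exp_poly_def mult_ac)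
  also have "E * fps_exp (real (Suc n)) = fps_exp (real n)"
    by (simp flip: fps_exp_add_mult)
  finally show ?thesis by (simp only: lagrange_coeff[of "lucky_fps i" n])
qed

lemma lucky_exp_poly_0 [simp]: "fps_nth (lucky_exp_poly i) 0 = 0"
  by (simp add: lucky_exp_poly_def nth_lucky_fps_eq_0)

lemma deriv_lucky_exp_poly:
  "fps_deriv (lucky_exp_poly i) = fps_const (fps_nth park_fps i) * fps_X ^ i * E ^ Suc i +
     (\<Sum>m<i. fps_const (real (Suc m) * fps_nth park_fps m) * fps_X ^ m * E ^ Suc m * lucky_exp_poly (i - Suc m))"
proof -
  define K where "K = lucky_fps i oo W"
  define D where "D = fps_deriv (lucky_fps i) oo W"
  define S where "S = (\<Sum>m<i. fps_const (real (Suc m) * fps_nth park_fps m) * W ^ m *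
     (lucky_fps (i - Suc m) oo W))"
  let ?p = "fps_const (fps_nth park_fps i)"
  have "fps_deriv (fps_X * lucky_fps i) = lucky_fps i + fps_X * fps_deriv (lucky_fps i)"
    by simp
  then have "D = (K + W * D) * fps_exp 1 + ?p * W ^ i * fps_exp 1 + S"
    unfolding D_def K_def S_def
    by (subst deriv_lucky_fps) (simp add: fps_compose_mult_distrib fps_compose_add_distrib
      fps_compose_sum_distrib park_fps_compose_W fps_compose_power[symmetric] del: of_nat_Suc)
  then have "D * E = (K + W * D) * (fps_exp 1 * E) + ?p * W ^ i * (fps_exp 1 * E) + S * E"
    by (metis distrib_right mult.assoc)
  \<comment> \<open>The left-hand side is the derivative of \<open>K\<close> by the chain rule,
    because \<open>W' = (1 - t) exp (-t)\<close>.\<close>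
  then have D: "(1 - fps_X) * E * D = K + ?p * W ^ i + S * E"
    by (simp add: algebra_simps)
  have "fps_deriv K = (1 - fps_X) * E * D"
    unfolding K_def D_def by (subst fps_compose_deriv) (simp_all only: deriv_W mult_ac, simp)
  then have "fps_deriv K = K + ?p * W ^ i + S * E"
    by (simp only: D)
  then have "fps_deriv (lucky_exp_poly i) = (K + ?p * W ^ i + S * E) * E - K * E"
    by (simp add: lucky_exp_poly_def deriv_E algebra_simps del: fps_exp_deriv flip: K_def)
  also have "\<dots> = ?p * W ^ i * E + S * E * E"
    by (simp add: algebra_simps)
  finally show ?thesis
    by (simp add: S_def sum_distrib_right sum_distrib_left lucky_exp_poly_def power_mult_distrib mult_ac del: of_nat_Suc)
qed

section \<open>Coefficient asymptotics\<close>

text \<open>With \<open>x = n + 1 - b\<close>, this is the coefficient of \<open>t^(n - a)\<close>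
  in \<open>(1 - t) exp (x t)\<close>. Its two terms combine to a multiple of
  \<open>x - (n - a) = a + 1 - b\<close>.\<close>

lemma nth_monomial:
  assumes "a < n"
  shows "fps_nth (fps_X ^ a * E ^ b * (1 - fps_X) * fps_exp (real (Suc n))) n =
    (real (Suc n) - real b) ^ (n - a - 1) * (real a + 1 - real b) / fact (n - a)"
proof -
  define m where "m = n - a - 1"
  then have m: "n - a = Suc m" using assms by simp
  define x where "x = real (Suc n) - real b"
  have "fps_X ^ a * E ^ b * (1 - fps_X) * fps_exp (real (Suc n)) =
      fps_X ^ a * ((1 - fps_X) * (E ^ b * fps_exp (real (Suc n))))"
    by (simp only: mult_ac)
  also have "E ^ b * fps_exp (real (Suc n)) = fps_exp x"
    by (simp add: E_power x_def flip: fps_exp_add_mult)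
  finally have "fps_nth (fps_X ^ a * E ^ b * (1 - fps_X) * fps_exp (real (Suc n))) n =
      fps_nth ((1 - fps_X) * fps_exp x) (Suc m)"
    using assms by (simp only: fps_X_power_mult_nth m[symmetric]) simp
  also have "\<dots> = x ^ Suc m / fact (Suc m) - x ^ m / fact m"
    by (simp add: left_diff_distrib del: fact_Suc power_Suc)
  also have "\<dots> = x ^ m * (x - real (Suc m)) / fact (Suc m)"
  proof -
    have "x ^ m / fact m = real (Suc m) * x ^ m / fact (Suc m)"
      by (simp del: of_nat_Suc)
    then show ?thesis by (simp add: diff_divide_distrib algebra_simps del: fact_Suc)
  qed
  also have "x - real (Suc m) = real a + 1 - real b"
    using assms by (simp add: x_def m_def of_nat_diff)
  finally show ?thesis by (simp add: m x_def del: fact_Suc)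
qed

text \<open>Lagrange inversion for \<open>exp t\<close>, the monomial with \<open>a = b = 0\<close>;
  it recovers the number \<open>(n + 1)^(n - 1)\<close> of parking functions.\<close>

lemma nth_park_fps_eq: "fps_nth park_fps n = real (Suc n) ^ (n - 1) / fact n"
proof (cases "n = 0")
  case False
  have "fps_nth park_fps n = fps_nth (fps_exp 1 * (1 - fps_X) * fps_exp (real n)) n"
    by (subst lagrange_coeff) (simp only: park_fps_compose_W)
  also have "fps_exp 1 * (1 - fps_X) * fps_exp (real n) =
      fps_X ^ 0 * E ^ 0 * (1 - fps_X) * fps_exp (real (Suc n))"
    by (simp add: mult_ac fps_exp_add_mult)
  finally show ?thesis using False by (subst (asm) nth_monomial) simp_all
qed (simp add: nth_park_fps)

text \<open>For \<open>f = lucky_exp_poly i\<close> and \<open>n > i\<close> this is the probability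
  that spot \<open>i + 1\<close> is lucky. It is linear in \<open>f\<close>, so limits can be taken
  monomial by monomial.\<close>

definition coeff_ratio :: "real fps \<Rightarrow> nat \<Rightarrow> real" where
  "coeff_ratio f n = fact n * fps_nth (f * (1 - fps_X) * fps_exp (real (Suc n))) n / real (Suc n) ^ (n - 1)"

lemma coeff_ratio_0: "coeff_ratio 0 n = 0"
  by (simp add: coeff_ratio_def)

lemma coeff_ratio_add: "coeff_ratio (f + g) n = coeff_ratio f n + coeff_ratio g n"
  by (simp add: coeff_ratio_def distrib_right distrib_left add_divide_distrib del: of_nat_Suc)

lemma coeff_ratio_const_mult: "coeff_ratio (fps_const c * f) n = c * coeff_ratio f n"
  by (simp add: coeff_ratio_def mult.assoc del: of_nat_Suc)

lemma falling_factorial_ratio_tendsto: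
  "(\<lambda>n. fact n / fact (n - a) / real (Suc n) ^ a) \<longlonglongrightarrow> 1"
proof (induction a)
  case (Suc a)
  \<comment> \<open>The new factor is
    \<open>(n - a) / (n + 1) = 1 - (a + 1) / (n + 1)\<close>.\<close>
  have "(\<lambda>n. fact n / fact (n - a) / real (Suc n) ^ a * (1 - real (Suc a) / real (Suc n))) \<longlonglongrightarrow> 1 * (1 - 0)"
    by (intro tendsto_mult Suc.IH tendsto_diff tendsto_const LIMSEQ_Suc lim_const_over_n)
  moreover have "\<forall>\<^sub>F n in sequentially. fact n / fact (n - a) / real (Suc n) ^ a * (1 - real (Suc a) / real (Suc n)) =
      fact n / fact (n - Suc a) / real (Suc n) ^ Suc a"
    using eventually_gt_at_top[of a]
  proof eventually_elim
    case (elim n)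
    then have "n - a = Suc (n - Suc a)" by simp
    then have "(fact (n - a) :: real) = (real n - real a) * fact (n - Suc a)"
      using elim by (simp add: of_nat_diff)
    moreover have "1 - real (Suc a) / real (Suc n) = (real n - real a) / real (Suc n)"
      by (simp add: field_simps)
    ultimately show ?case using elim by simp
  qed
  ultimately show ?case by (simp add: tendsto_cong)
qed simp

lemma power_ratio_tendsto:
  "(\<lambda>n. ((real (Suc n) - x) / real (Suc n)) ^ (n - k)) \<longlonglongrightarrow> exp (- x)"
proof -
  let ?r = "\<lambda>n. 1 + (- x) / real (Suc n)"
  have "?r \<longlonglongrightarrow> 1 + 0"
    by (intro tendsto_add tendsto_const LIMSEQ_Suc lim_const_over_n)
  then have r: "?r \<longlonglongrightarrow> 1" by simp
  \<comment> \<open>The exponent \<open>n - k\<close> is \<open>(n + 1) - (k + 1)\<close>; the power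
    with fixed exponent \<open>k + 1\<close> tends to 1.\<close>
  have "(\<lambda>n. ?r n ^ Suc n / ?r n ^ Suc k) \<longlonglongrightarrow> exp (- x) / 1 ^ Suc k"
    by (intro tendsto_divide tendsto_power r LIMSEQ_Suc[OF tendsto_exp_limit_sequentially]) simp
  moreover have "\<forall>\<^sub>F n in sequentially. ?r n ^ Suc n / ?r n ^ Suc k = ((real (Suc n) - x) / real (Suc n)) ^ (n - k)"
    using order_tendstoD(1)[OF r zero_less_one] eventually_ge_at_top[of k]
  proof eventually_elim
    case (elim n)
    have "?r n = (real (Suc n) - x) / real (Suc n)" by (simp add: field_simps)
    moreover have "?r n ^ Suc n / ?r n ^ Suc k = ?r n ^ (Suc n - Suc k)"
      using elim by (subst power_diff) auto
    ultimately show ?case by simp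
  qed
  ultimately show ?thesis by (simp add: tendsto_cong)
qed

lemma coeff_ratio_monomial_tendsto:
  "coeff_ratio (fps_X ^ a * E ^ b) \<longlonglongrightarrow> (real a + 1 - real b) * exp (- real b)"
proof -
  let ?f = "\<lambda>n. fact n / fact (n - a) / real (Suc n) ^ a *
    ((real (Suc n) - real b) / real (Suc n)) ^ (n - Suc a) * (real a + 1 - real b)"
  have "?f \<longlonglongrightarrow> 1 * exp (- real b) * (real a + 1 - real b)"
    by (intro tendsto_mult falling_factorial_ratio_tendsto power_ratio_tendsto tendsto_const)
  moreover have "\<forall>\<^sub>F n in sequentially. ?f n = coeff_ratio (fps_X ^ a * E ^ b) n"
    using eventually_gt_at_top[of a]
  proof eventually_elim
    case (elim n)
    then have "n - 1 = a + (n - Suc a)" by simp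
    then have "real (Suc n) ^ (n - 1) = real (Suc n) ^ a * real (Suc n) ^ (n - Suc a)"
      by (metis power_add)
    then show ?case
      unfolding coeff_ratio_def nth_monomial[OF elim]
      by (simp add: power_divide mult_ac del: of_nat_Suc)
  qed
  ultimately show ?thesis by (simp add: tendsto_cong mult.commute)
qed

text \<open>A triple \<open>(c, a, b)\<close> stands for the term \<open>c t^a exp (-b t)\<close>,
  so that limits become finite sums over the list.\<close>

definition exp_poly :: "(int \<times> nat \<times> nat) list \<Rightarrow> real fps" where
  "exp_poly cs = (\<Sum>(c, a, b)\<leftarrow>cs. of_int c * (fps_X ^ a * E ^ b))"

lemma coeff_ratio_exp_poly_tendsto:
  "coeff_ratio (exp_poly cs) \<longlonglongrightarrow> (\<Sum>(c, a, b)\<leftarrow>cs. of_int c * ((real a + 1 - real b) * exp (- real b)))"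
proof (induction cs)
  case Nil
  then show ?case by (simp add: exp_poly_def coeff_ratio_0[abs_def])
next
  case (Cons x cs)
  obtain c a b where x: "x = (c, a, b)" by (cases x)
  have "exp_poly (x # cs) = fps_const (of_int c) * (fps_X ^ a * E ^ b) + exp_poly cs"
    by (simp add: exp_poly_def x fps_of_int)
  then have "coeff_ratio (exp_poly (x # cs)) = (\<lambda>n. of_int c * coeff_ratio (fps_X ^ a * E ^ b) n + coeff_ratio (exp_poly cs) n)"
    by (simp add: fun_eq_iff coeff_ratio_add coeff_ratio_const_mult)
  then show ?case
    by (simp add: x) (intro tendsto_add tendsto_mult tendsto_const coeff_ratio_monomial_tendsto Cons.IH)
qed

lemma lucky_spot_prob_eq:
  assumes "i < n"
  shows "lucky_spot_prob (Suc i) n = coeff_ratio (lucky_exp_poly i) n"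
proof -
  have "(\<Sum>k = 1..n. real (q n k (Suc i))) = real (fillings {Suc i} {1..n})"
    using assms sum_q[of "Suc i" n] by (simp flip: of_nat_sum)
  also have "\<dots> = fact n * fps_nth (lucky_fps i) n"
    using assms by (simp add: nth_lucky_fps)
  finally show ?thesis
    by (simp add: lucky_spot_prob_def coeff_ratio_def nth_lucky_fps_eq)
qed

text \<open>The constant \<open>c\<close> is a common denominator that keeps the coefficients in
  \<open>cs\<close> integral.\<close>

lemma lucky_spot_prob_tendsto:
  assumes "fps_const c * lucky_exp_poly i = exp_poly cs" "c \<noteq> 0"
  shows "lucky_spot_prob (Suc i) \<longlonglongrightarrow>
    (\<Sum>(k, a, b)\<leftarrow>cs. of_int k * ((real a + 1 - real b) * exp (- real b))) / c"
proof -
  have "(\<lambda>n. coeff_ratio (exp_poly cs) n / c) \<longlonglongrightarrow>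
      (\<Sum>(k, a, b)\<leftarrow>cs. of_int k * ((real a + 1 - real b) * exp (- real b))) / c"
    by (intro tendsto_divide coeff_ratio_exp_poly_tendsto tendsto_const assms)
  moreover have "coeff_ratio (exp_poly cs) n / c = coeff_ratio (lucky_exp_poly i) n" for n
    using assms(2) by (simp flip: assms(1) add: coeff_ratio_const_mult)
  ultimately have "coeff_ratio (lucky_exp_poly i) \<longlonglongrightarrow>
      (\<Sum>(k, a, b)\<leftarrow>cs. of_int k * ((real a + 1 - real b) * exp (- real b))) / c"
    by simp
  moreover have "\<forall>\<^sub>F n in sequentially. coeff_ratio (lucky_exp_poly i) n = lucky_spot_prob (Suc i) n"
    using eventually_gt_at_top[of i] by eventually_elim (simp add: lucky_spot_prob_eq)
  ultimately show ?thesis by (simp add: tendsto_cong)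
qed

section \<open>The first five spots\<close>

text \<open>A series is determined by its derivative and constant term, and
  \<open>lucky_exp_poly i\<close> has constant term 0.\<close>

lemma lucky_exp_poly_eqI:
  assumes "fps_const c * fps_deriv (lucky_exp_poly i) = fps_deriv (exp_poly cs)" "fps_nth (exp_poly cs) 0 = 0"
  shows "fps_const c * lucky_exp_poly i = exp_poly cs"
  using assms fps_deriv_eq_iff[of "fps_const c * lucky_exp_poly i" "exp_poly cs"] by simp

lemma lucky_exp_poly_0_eq: "fps_const 1 * lucky_exp_poly 0 = exp_poly [(1, 0, 0), (-1, 0, 1)]"
  by (rule lucky_exp_poly_eqI)
    (simp_all add: deriv_lucky_exp_poly nth_park_fps_eq exp_poly_def deriv_E del: fps_exp_deriv)

lemmas deriv_exp_poly_simps = exp_poly_def deriv_E fps_deriv_power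

lemmas deriv_lucky_exp_poly_simps = deriv_lucky_exp_poly nth_park_fps_eq fact_numeral
  numeral_fps_const

text \<open>The list results from integrating \<open>deriv_lucky_exp_poly\<close> and clearing
  denominators; the same holds for the next three spots. Here \<open>p_0 = p_1 = 1\<close>.\<close>

lemma lucky_exp_poly_1_eq:
  "fps_const 4 * lucky_exp_poly (Suc 0) = exp_poly [(3, 0, 0), (-4, 0, 1), (1, 0, 2), (-2, 1, 2)]"
proof (rule lucky_exp_poly_eqI)
  let ?G = lucky_exp_poly
  have "fps_const 4 * fps_deriv (?G (Suc 0)) = 4 * fps_X * E ^ 2 + 4 * E * (fps_const 1 * ?G 0)"
    by (simp add: deriv_lucky_exp_poly_simps algebra_simps eval_nat_numeral)
  then show "fps_const 4 * fps_deriv (?G (Suc 0)) = fps_deriv (exp_poly [(3, 0, 0), (-4, 0, 1), (1, 0, 2), (-2, 1, 2)])"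
    by (simp only: lucky_exp_poly_0_eq)
     (simp add: deriv_exp_poly_simps algebra_simps eval_nat_numeral del: fps_exp_deriv)
qed (simp add: exp_poly_def E_power)

lemma lucky_exp_poly_2_eq:
  "fps_const 12 * lucky_exp_poly 2 = exp_poly [(8, 0, 0), (-9, 0, 1), (-12, 1, 2), (1, 0, 3), (6, 1, 3), (-6, 2, 3)]" (is "_ = exp_poly ?cs")
proof (rule lucky_exp_poly_eqI)
  let ?G = lucky_exp_poly
  \<comment> \<open>With \<open>p_2 = 3/2\<close> the first coefficient is
    \<open>12 p_2 = 18\<close>; the others are \<open>12 (m + 1) p_m\<close> divided by the
    denominators 4 and 1 of the earlier formulas.\<close>
  have "fps_const 12 * fps_deriv (?G 2) = 18 * fps_X ^ 2 * E ^ 3 + 3 * E * (fps_const 4 * ?G (Suc 0)) +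
      24 * fps_X * E ^ 2 * (fps_const 1 * ?G 0)"
    by (simp add: deriv_lucky_exp_poly_simps algebra_simps eval_nat_numeral)
  then show "fps_const 12 * fps_deriv (?G 2) = fps_deriv (exp_poly ?cs)"
    by (simp only: lucky_exp_poly_0_eq lucky_exp_poly_1_eq)
     (simp add: deriv_exp_poly_simps algebra_simps eval_nat_numeral del: fps_exp_deriv)
qed (simp add: exp_poly_def E_power)

lemma lucky_exp_poly_3_eq:
  "fps_const 24 * lucky_exp_poly 3 = exp_poly [(15, 0, 0), (-16, 0, 1), (-18, 1, 2), (-36, 2, 3),
     (1, 0, 4), (6, 1, 4), (24, 2, 4), (-16, 3, 4)]" (is "_ = exp_poly ?cs")
proof (rule lucky_exp_poly_eqI)
  let ?G = lucky_exp_poly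
  have "fps_const 24 * fps_deriv (?G 3) = 64 * fps_X ^ 3 * E ^ 4 + 2 * E * (fps_const 12 * ?G 2) +
      12 * fps_X * E ^ 2 * (fps_const 4 * ?G (Suc 0)) + 108 * fps_X ^ 2 * E ^ 3 * (fps_const 1 * ?G 0)"
    by (simp add: deriv_lucky_exp_poly_simps algebra_simps eval_nat_numeral)
  then show "fps_const 24 * fps_deriv (?G 3) = fps_deriv (exp_poly ?cs)"
    by (simp only: lucky_exp_poly_0_eq lucky_exp_poly_1_eq lucky_exp_poly_2_eq)
     (simp add: deriv_exp_poly_simps algebra_simps eval_nat_numeral del: fps_exp_deriv)
qed (simp add: exp_poly_def E_power)

lemma lucky_exp_poly_4_eq:
  "fps_const 120 * lucky_exp_poly 4 = exp_poly [(72, 0, 0), (-75, 0, 1), (-80, 1, 2), (-135, 2, 3),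
     (-320, 3, 4), (3, 0, 5), (20, 1, 5), (75, 2, 5), (250, 3, 5), (-125, 4, 5)]" (is "_ = exp_poly ?cs")
proof (rule lucky_exp_poly_eqI)
  let ?G = lucky_exp_poly
  \<comment> \<open>Here \<open>p_3 = 8/3\<close> and \<open>p_4 = 125/24\<close>; the coefficients
    \<open>120 (m + 1) p_m\<close> are divided by the earlier denominators 24, 12, 4 and 1.\<close>
  have "fps_const 120 * fps_deriv (?G 4) = 625 * fps_X ^ 4 * E ^ 5 + 5 * E * (fps_const 24 * ?G 3) +
      20 * fps_X * E ^ 2 * (fps_const 12 * ?G 2) + 135 * fps_X ^ 2 * E ^ 3 * (fps_const 4 * ?G (Suc 0)) +
      1280 * fps_X ^ 3 * E ^ 4 * (fps_const 1 * ?G 0)"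
    by (simp add: deriv_lucky_exp_poly_simps algebra_simps eval_nat_numeral)
  then show "fps_const 120 * fps_deriv (?G 4) = fps_deriv (exp_poly ?cs)"
    by (simp only: lucky_exp_poly_0_eq lucky_exp_poly_1_eq lucky_exp_poly_2_eq lucky_exp_poly_3_eq)
     (simp add: deriv_exp_poly_simps algebra_simps eval_nat_numeral del: fps_exp_deriv)
qed (simp add: exp_poly_def E_power)

theorem mainTheorem9:
  shows "(\<forall>j\<in>{1..5}. convergent (lucky_spot_prob j)) \<and>
    rho 1 = 1 \<and>
    rho 2 = 3/4 - 1/4 * exp (-2) \<and>
    rho 3 = 2/3 - 2/3 * exp (-3) \<and>
    rho 4 = 5/8 - 13/8 * exp (-4) \<and>
    rho 5 = 3/5 - 59/15 * exp (-5)"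
proof -
  \<comment> \<open>Terms with \<open>b = a + 1\<close> contribute 0 to the limit. For spot
    \<open>j\<close> only the constant and the terms with \<open>b = j\<close> >
    \<open>a + 1\<close> remain, hence the shape of the values.\<close>
  have l1: "lucky_spot_prob 1 \<longlonglongrightarrow> 1"
    using lucky_spot_prob_tendsto[OF lucky_exp_poly_0_eq] by simp
  have l2: "lucky_spot_prob 2 \<longlonglongrightarrow> 3/4 - 1/4 * exp (-2)"
    using lucky_spot_prob_tendsto[OF lucky_exp_poly_1_eq] by (simp add: numeral_2_eq_2 field_simps)
  have l3: "lucky_spot_prob 3 \<longlonglongrightarrow> 2/3 - 2/3 * exp (-3)"
    using lucky_spot_prob_tendsto[OF lucky_exp_poly_2_eq] by (simp add: diff_divide_distrib)
  have l4: "lucky_spot_prob 4 \<longlonglongrightarrow> 5/8 - 13/8 * exp (-4)"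
    using lucky_spot_prob_tendsto[OF lucky_exp_poly_3_eq] by (simp add: diff_divide_distrib)
  have l5: "lucky_spot_prob 5 \<longlonglongrightarrow> 3/5 - 59/15 * exp (-5)"
    using lucky_spot_prob_tendsto[OF lucky_exp_poly_4_eq] by (simp add: diff_divide_distrib)
  have "j \<in> {1, 2, 3, 4, 5}" if "j \<in> {1..5}" for j :: nat
    using that by auto
  then have "convergent (lucky_spot_prob j)" if "j \<in> {1..5}" for j
    using that l1 l2 l3 l4 l5 unfolding convergent_def by blast
  with l1 l2 l3 l4 l5 show ?thesis
    unfolding rho_def by (blast dest: limI)
qed

end
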